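(* Let $\gamma$ be a smooth plane curve, and let $p_1=\gamma_1(t)=(t,f(t))$ and $p_2=\gamma_2(s)=(s,f(s))$ be two points of $\gamma$, where $f$ is smooth with $f''$ nowhere zero. Let $\alpha\in(0,1)$ with $\alpha\neq\frac12$. When the parameter $s$ tends to $t$, the intermediate line of the pair $(p_1,p_2)$ tends to the tangent line of $\gamma$ at the point $p_1$.
   Context: For $s\neq t$, the intermediate point is $M_\alpha=(1-\alpha)p_1+\alpha p_2$, and the intermediate line of the pair $(p_1,p_2)$ is the line through $M_\alpha$ and the intersection point of the tangent lines of $\gamma$ at $p_1$ and $p_2$ (these are not parallel for $s\ne t$ since $f''\neq0$). *)

theory Defs
  imports "HOL-Analysis.Analysis"
begin

definition smooth_on :: "(real \<Rightarrow> real) \<Rightarrow> real set \<Rightarrow> bool" where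
  "smooth_on f I \<longleftrightarrow> (\<forall>n. \<forall>x\<in>I. ((deriv ^^ n) f) differentiable (at x))"

definition graph_curve :: "(real \<Rightarrow> real) \<Rightarrow> real \<Rightarrow> real \<times> real" where
  "graph_curve f x = (x, f x)"

definition line_dir :: "'a::real_vector \<Rightarrow> 'a \<Rightarrow> 'a set" where
  "line_dir p v = {p + r *\<^sub>R v | r. True}"

definition tangent_line :: "(real \<Rightarrow> 'a::real_normed_vector) \<Rightarrow> real \<Rightarrow> 'a set" where
  "tangent_line \<gamma> x = line_dir (\<gamma> x) (vector_derivative \<gamma> (at x))"

definition tangent_intersection :: "(real \<Rightarrow> 'a::real_normed_vector) \<Rightarrow> real \<Rightarrow> real \<Rightarrow> 'a" where
  "tangent_intersection \<gamma> t s = (THE q. q \<in> tangent_line \<gamma> t \<inter> tangent_line \<gamma> s)"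

definition intermediate_point :: "real \<Rightarrow> (real \<Rightarrow> 'a::real_normed_vector) \<Rightarrow> real \<Rightarrow> real \<Rightarrow> 'a" where
  "intermediate_point \<alpha> \<gamma> t s = (1 - \<alpha>) *\<^sub>R \<gamma> t + \<alpha> *\<^sub>R \<gamma> s"

definition intermediate_line :: "real \<Rightarrow> (real \<Rightarrow> 'a::real_normed_vector) \<Rightarrow> real \<Rightarrow> real \<Rightarrow> 'a set" where
  "intermediate_line \<alpha> \<gamma> t s =
     affine hull {intermediate_point \<alpha> \<gamma> t s, tangent_intersection \<gamma> t s}"

text \<open>
  Convergence in the usual topology on the space of affine lines: along the filter, the sets
  \<open>L s\<close> are (eventually) genuine lines that have base points and nonzero direction vectors
  converging to a base point and a nonzero direction vector of the limit line. Since \<open>v0 \<noteq> 0\<close>,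
  one could equivalently normalise the directions to unit length.
\<close>

definition lines_tendsto :: "('b \<Rightarrow> 'a::real_normed_vector set) \<Rightarrow> 'a set \<Rightarrow> 'b filter \<Rightarrow> bool" where
  "lines_tendsto L L0 F \<longleftrightarrow>
     (\<exists>p v p0 v0. v0 \<noteq> 0 \<and> L0 = line_dir p0 v0 \<and>
        (\<forall>\<^sub>F s in F. v s \<noteq> 0 \<and> L s = line_dir (p s) (v s)) \<and>
        (p \<longlongrightarrow> p0) F \<and> (v \<longlongrightarrow> v0) F)"

text \<open>
  The definite description in \<open>tangent_intersection\<close> is justified for graphs of smooth
  functions with nowhere vanishing second derivative on an interval.
\<close>

lemma tangent_line_graph_curve:
  assumes "f differentiable (at x)"
  shows "tangent_line (graph_curve f) x = {q. snd q = f x + deriv f x * (fst q - x)}"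
proof -
  have "(f has_field_derivative deriv f x) (at x)"
    using assms DERIV_deriv_iff_real_differentiable by blast
  then have "(graph_curve f has_vector_derivative (1, deriv f x)) (at x)"
    unfolding graph_curve_def[abs_def]
    by (intro has_vector_derivative_Pair)
       (auto simp: has_real_derivative_iff_has_vector_derivative has_vector_derivative_id)
  then have vd: "vector_derivative (graph_curve f) (at x) = (1, deriv f x)"
    by (rule vector_derivative_at)
  show ?thesis
    unfolding tangent_line_def vd line_dir_def graph_curve_def
  proof (intro set_eqI iffI)
    fix q :: "real \<times> real"
    assume "q \<in> {q. snd q = f x + deriv f x * (fst q - x)}"
    then have "q = (x, f x) + (fst q - x) *\<^sub>R (1, deriv f x)"
      by (simp add: prod_eq_iff)
    then show "q \<in> {(x, f x) + r *\<^sub>R (1, deriv f x) | r. True}" by blast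
  qed auto
qed

lemma ex1_tangent_intersection:
  assumes "open I" "is_interval I" "smooth_on f I"
    and "\<forall>x\<in>I. deriv (deriv f) x \<noteq> 0" "t \<in> I" "s \<in> I" "s \<noteq> t"
  shows "\<exists>!q. q \<in> tangent_line (graph_curve f) t \<inter> tangent_line (graph_curve f) s"
proof -
  have "((deriv ^^ n) f) differentiable (at x)" if "x \<in> I" for n x
    using assms(3) that unfolding smooth_on_def by blast
  from this[of _ 0] this[of _ "Suc 0"]
  have d0: "f differentiable (at x)" and d1: "deriv f differentiable (at x)" if "x \<in> I" for x
    using that by simp_all
  have neq: "deriv f a \<noteq> deriv f b" if ab: "a \<in> I" "b \<in> I" "a < b" for a b
  proof
    assume eq: "deriv f a = deriv f b"
    have sub: "x \<in> I" if "a \<le> x" "x \<le> b" for x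
      using assms(2) ab that unfolding is_interval_1 by blast
    have cont: "continuous_on {a..b} (deriv f)"
      using d1 sub
      by (intro continuous_at_imp_continuous_on ballI) (auto intro: differentiable_imp_continuous_within)
    obtain z where "a < z" "z < b" "DERIV (deriv f) z :> 0"
      using Rolle[OF ab(3) eq cont] d1 sub by force
    then show False
      using DERIV_imp_deriv assms(4) sub by (metis less_imp_le)
  qed
  have ne: "deriv f t - deriv f s \<noteq> 0"
    using neq[OF assms(5,6)] neq[OF assms(6,5)] assms(7) by linarith
  define x0 where "x0 = (f s - deriv f s * s - f t + deriv f t * t) / (deriv f t - deriv f s)"
  have iff: "f t + deriv f t * (x - t) = f s + deriv f s * (x - s) \<longleftrightarrow> x = x0" for x
  proof -
    have "x = x0 \<longleftrightarrow> x * (deriv f t - deriv f s) = f s - deriv f s * s - f t + deriv f t * t"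
      unfolding x0_def using ne by (rule nonzero_eq_divide_eq)
    then show ?thesis by (simp add: algebra_simps)
  qed
  show ?thesis
    unfolding tangent_line_graph_curve[OF d0[OF assms(5)]] tangent_line_graph_curve[OF d0[OF assms(6)]]
  proof (rule ex1I[of _ "(x0, f t + deriv f t * (x0 - t))"])
    have "f t + deriv f t * (x0 - t) = f s + deriv f s * (x0 - s)"
      using iff by blast
    then show "(x0, f t + deriv f t * (x0 - t))
        \<in> {q. snd q = f t + deriv f t * (fst q - t)} \<inter> {q. snd q = f s + deriv f s * (fst q - s)}"
      unfolding Int_iff mem_Collect_eq fst_conv snd_conv by (intro conjI refl)
  next
    fix q
    assume "q \<in> {q. snd q = f t + deriv f t * (fst q - t)} \<inter> {q. snd q = f s + deriv f s * (fst q - s)}"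
    then have q: "snd q = f t + deriv f t * (fst q - t)" "snd q = f s + deriv f s * (fst q - s)"
      by blast+
    then have "fst q = x0"
      using iff by metis
    with q(1) show "q = (x0, f t + deriv f t * (x0 - t))"
      by (metis prod.collapse)
  qed
qed

end

theory Submission
  imports Defs
begin

text \<open>
  Put \<open>h = s - t\<close> and \<open>\<gamma> = graph_curve f\<close>. The tangents at \<open>\<gamma> t\<close> and \<open>\<gamma> s\<close> meet at
  \<open>\<gamma> t + x \<cdot> (1, f' t)\<close> with \<open>x = (f' s \<cdot> h - (f s - f t)) / (f' s - f' t)\<close>, and
  \<open>x / h \<rightarrow> 1/2\<close> since the numerator is \<open>f'' t \<cdot> h\<^sup>2 / 2 + o(h\<^sup>2)\<close> and the denominator
  \<open>f'' t \<cdot> h + o(h)\<close>. As \<open>M\<^sub>\<alpha> = \<gamma> t + \<alpha> h \<cdot> (1, f' t) + o(h)\<close>, the vector from \<open>M\<^sub>\<alpha>\<close> to the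
  intersection point, divided by \<open>h\<close>, tends to \<open>(1/2 - \<alpha>) \<cdot> (1, f' t)\<close>, a nonzero direction of
  the tangent exactly because \<open>\<alpha> \<noteq> 1/2\<close>.
\<close>

lemma line_dir_scaleR:
  assumes "c \<noteq> 0"
  shows "line_dir p (c *\<^sub>R v) = line_dir p v"
proof -
  have "p + r *\<^sub>R v = p + (r / c) *\<^sub>R c *\<^sub>R v" for r
    using assms by simp
  then show ?thesis
    unfolding line_dir_def by (auto simp only: scaleR_scaleR)
qed

lemma affine_hull_2_line_dir: "affine hull {p, q} = line_dir p (q - p)"
proof (intro set_eqI iffI)
  fix z assume "z \<in> affine hull {p, q}"
  then obtain u v where z: "z = u *\<^sub>R p + v *\<^sub>R q" and "u + v = 1"
    unfolding affine_hull_2 by blast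
  from \<open>u + v = 1\<close> have "u = 1 - v" by simp
  with z have "z = p + v *\<^sub>R (q - p)"
    by (simp add: algebra_simps)
  then show "z \<in> line_dir p (q - p)"
    unfolding line_dir_def by blast
next
  fix z assume "z \<in> line_dir p (q - p)"
  then obtain r where "z = (1 - r) *\<^sub>R p + r *\<^sub>R q"
    unfolding line_dir_def by (auto simp: algebra_simps)
  then show "z \<in> affine hull {p, q}"
    unfolding affine_hull_2 by (intro CollectI exI[of _ "1 - r"] exI[of _ r]) simp
qed

text \<open>Makes a direction vector of the tangent explicit, so that the tangent can be matched
  with the limit line required by \<open>lines_tendsto\<close>.\<close>

lemma tangent_line_graph_curve_eq_line_dir:
  assumes "f differentiable (at x)"
  shows "tangent_line (graph_curve f) x = line_dir (graph_curve f x) (1, deriv f x)"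
proof (intro set_eqI iffI)
  fix q assume "q \<in> tangent_line (graph_curve f) x"
  then have "q = graph_curve f x + (fst q - x) *\<^sub>R (1, deriv f x)"
    by (simp add: tangent_line_graph_curve[OF assms] graph_curve_def prod_eq_iff)
  then show "q \<in> line_dir (graph_curve f x) (1, deriv f x)"
    unfolding line_dir_def by blast
qed (auto simp: tangent_line_graph_curve[OF assms] graph_curve_def line_dir_def)

lemma tangent_intersection_graph_curve:
  assumes "f differentiable (at t)" "f differentiable (at s)" "deriv f s \<noteq> deriv f t"
  defines "x \<equiv> (deriv f s * (s - t) - (f s - f t)) / (deriv f s - deriv f t)"
  shows "tangent_intersection (graph_curve f) t s = (t + x, f t + deriv f t * x)"
proof -
  \<comment> \<open>Here \<open>y\<close> is the horizontal offset from \<open>t\<close>. Equality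
    of the two tangent heights at \<open>t + y\<close> is a linear equation in \<open>y\<close> with
    coefficient \<open>deriv f s - deriv f t\<close>, so distinct slopes give exactly one
    solution.\<close>
  have iff: "f t + deriv f t * y = f s + deriv f s * (t + y - s) \<longleftrightarrow> y = x" for y
  proof -
    have "y = x \<longleftrightarrow> y * (deriv f s - deriv f t) = deriv f s * (s - t) - (f s - f t)"
      unfolding x_def using assms(3) by (intro nonzero_eq_divide_eq) simp
    then show ?thesis by (auto simp: algebra_simps)
  qed
  show ?thesis
    unfolding tangent_intersection_def tangent_line_graph_curve[OF assms(1)]
      tangent_line_graph_curve[OF assms(2)]
  proof (rule the_equality)
    show "(t + x, f t + deriv f t * x) \<in> {q. snd q = f t + deriv f t * (fst q - t)} \<inter>
        {q. snd q = f s + deriv f s * (fst q - s)}"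
      using iff[of x] by simp
  next
    fix q
    assume "q \<in> {q. snd q = f t + deriv f t * (fst q - t)} \<inter>
        {q. snd q = f s + deriv f s * (fst q - s)}"
    with iff[of "fst q - t"] show "q = (t + x, f t + deriv f t * x)"
      by (auto simp: prod_eq_iff)
  qed
qed

text \<open>The numerator is the first-order Taylor remainder at \<open>t\<close> of the expansion
  of \<open>f\<close> about \<open>s\<close>. Its derivative in \<open>s\<close> is just
  \<open>f'' s * (s - t)\<close>, since the two \<open>f' s\<close> terms cancel. One use of
  l'Hopital's rule therefore suffices, and no derivative of \<open>f''\<close> enters.\<close>

lemma tendsto_tangent_remainder:
  fixes f f' f'' :: "real \<Rightarrow> real"
  assumes "\<forall>\<^sub>F s in nhds t. (f has_real_derivative f' s) (at s)"
    and "\<forall>\<^sub>F s in nhds t. (f' has_real_derivative f'' s) (at s)"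
    and "isCont f'' t"
  shows "((\<lambda>s. (f' s * (s - t) - (f s - f t)) / (s - t)\<^sup>2) \<longlongrightarrow> f'' t / 2) (at t)"
proof (rule lhopital[where f' = "\<lambda>s. f'' s * (s - t)" and g' = "\<lambda>s. 2 * (s - t)"])
  have *: "isCont f t" "isCont f' t"
    using eventually_nhds_x_imp_x[OF assms(1)] eventually_nhds_x_imp_x[OF assms(2)]
    by (auto intro: DERIV_isCont)
  have "((\<lambda>s. f' s * (s - t) - (f s - f t)) \<longlongrightarrow> f' t * (t - t) - (f t - f t)) (at t)"
    using * unfolding isCont_def by (intro tendsto_intros)
  then show "((\<lambda>s. f' s * (s - t) - (f s - f t)) \<longlongrightarrow> 0) (at t)" by simp
  have "((\<lambda>s. (s - t)\<^sup>2) \<longlongrightarrow> (t - t)\<^sup>2) (at t)"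
    by (intro tendsto_intros)
  then show "((\<lambda>s. (s - t)\<^sup>2) \<longlongrightarrow> 0) (at t)" by simp
  have ne: "\<forall>\<^sub>F s in at t. s \<noteq> t"
    by (simp add: eventually_neq_at_within)
  then show "\<forall>\<^sub>F s in at t. (s - t)\<^sup>2 \<noteq> 0" "\<forall>\<^sub>F s in at t. 2 * (s - t) \<noteq> 0"
    by (auto elim: eventually_mono)
  have at: "\<forall>\<^sub>F s in at t. P s" if "\<forall>\<^sub>F s in nhds t. P s" for P
    using that by (auto simp: eventually_at_filter elim: eventually_mono)
  show "\<forall>\<^sub>F s in at t. ((\<lambda>s. f' s * (s - t) - (f s - f t)) has_real_derivative f'' s * (s - t)) (at s)"
    using at[OF assms(1)] at[OF assms(2)]
    by eventually_elim (auto intro!: derivative_eq_intros)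
  show "\<forall>\<^sub>F s in at t. ((\<lambda>s. (s - t)\<^sup>2) has_real_derivative 2 * (s - t)) (at s)"
    by (auto intro!: always_eventually derivative_eq_intros)
  \<comment> \<open>Off \<open>t\<close> the factor \<open>s - t\<close> cancels from the quotient
    of derivatives; continuity of \<open>f''\<close> at \<open>t\<close> gives the limit.\<close>
  have "((\<lambda>s. f'' s / 2) \<longlongrightarrow> f'' t / 2) (at t)"
    using assms(3) unfolding isCont_def by (intro tendsto_intros) auto
  then show "((\<lambda>s. f'' s * (s - t) / (2 * (s - t))) \<longlongrightarrow> f'' t / 2) (at t)"
    by (rule Lim_transform_eventually) (use ne in eventually_elim, simp only: nonzero_mult_divide_mult_cancel_right right_minus_eq not_False_eq_True)
qed

theorem theorem4p6:
  fixes f :: "real \<Rightarrow> real" and I :: "real set" and \<alpha> t :: real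
  assumes "open I" and "is_interval I"
    and "smooth_on f I"
    and "\<forall>x\<in>I. deriv (deriv f) x \<noteq> 0"
    and "t \<in> I"
    and "0 < \<alpha>" and "\<alpha> < 1" and "\<alpha> \<noteq> 1/2"
  shows "lines_tendsto (\<lambda>s. intermediate_line \<alpha> (graph_curve f) t s)
           (tangent_line (graph_curve f) t) (at t)"
proof -
  have "((deriv ^^ n) f) differentiable (at x)" if "x \<in> I" for n x
    using assms(3) that unfolding smooth_on_def by blast
  from this[of _ 0] this[of _ "Suc 0"] this[of _ "Suc (Suc 0)"]
  have d0: "f differentiable (at x)" and d1: "deriv f differentiable (at x)"
    and d2: "deriv (deriv f) differentiable (at x)" if "x \<in> I" for x
    using that by simp_all
  note D0 = d0[THEN DERIV_deriv_iff_real_differentiable[THEN iffD2]]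
  note D1 = d1[THEN DERIV_deriv_iff_real_differentiable[THEN iffD2]]
  have nI: "\<forall>\<^sub>F s in nhds t. s \<in> I"
    using assms(1,5) by (rule eventually_nhds_in_open)
  have ne: "\<forall>\<^sub>F s in at t. s \<noteq> t"
    by (simp add: eventually_neq_at_within)
  have aI: "\<forall>\<^sub>F s in at t. s \<in> I"
    using nI by (auto simp: eventually_at_filter elim: eventually_mono)
  define c where "c = deriv (deriv f) t"
  have c: "c \<noteq> 0" using assms(4,5) by (simp add: c_def)
  have slope: "((\<lambda>s. (f s - f t) / (s - t)) \<longlongrightarrow> deriv f t) (at t)"
    and slope': "((\<lambda>s. (deriv f s - deriv f t) / (s - t)) \<longlongrightarrow> c) (at t)"
    using D0[OF assms(5)] D1[OF assms(5)] by (simp_all add: has_field_derivative_iff c_def)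
  have rem: "((\<lambda>s. (deriv f s * (s - t) - (f s - f t)) / (s - t)\<^sup>2) \<longlongrightarrow> c / 2) (at t)"
    unfolding c_def
  proof (rule tendsto_tangent_remainder)
    show "\<forall>\<^sub>F s in nhds t. (f has_real_derivative deriv f s) (at s)"
      "\<forall>\<^sub>F s in nhds t. (deriv f has_real_derivative deriv (deriv f) s) (at s)"
      using nI by (auto elim: eventually_mono intro: D0 D1)
    show "isCont (deriv (deriv f)) t"
      using d2[OF assms(5)] by (rule differentiable_imp_continuous_within)
  qed
  \<comment> \<open>The difference quotient of \<open>deriv f\<close> has the nonzero limit
    \<open>c\<close>, so its numerator is eventually nonzero; this local argument replaces one by
    Rolle's theorem.\<close>
  have dne: "\<forall>\<^sub>F s in at t. deriv f s \<noteq> deriv f t"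
    using tendsto_imp_eventually_ne[OF slope' c] by (auto elim: eventually_mono)
  define x where "x s = (deriv f s * (s - t) - (f s - f t)) / (deriv f s - deriv f t)" for s
  have x_lim: "((\<lambda>s. x s / (s - t)) \<longlongrightarrow> 1/2) (at t)"
  proof (rule Lim_transform_eventually)
    \<comment> \<open>Numerator and denominator of \<open>x s\<close> are scaled by their own
      orders, \<open>(s - t)\<^sup>2\<close> and \<open>s - t\<close>; the limits
      \<open>c / 2\<close> and \<open>c\<close> leave 1/2.\<close>
    show "((\<lambda>s. (deriv f s * (s - t) - (f s - f t)) / (s - t)\<^sup>2 /
        ((deriv f s - deriv f t) / (s - t))) \<longlongrightarrow> 1/2) (at t)"
      using tendsto_divide[OF rem slope' c] c by simp
    show "\<forall>\<^sub>F s in at t. (deriv f s * (s - t) - (f s - f t)) / (s - t)\<^sup>2 /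
        ((deriv f s - deriv f t) / (s - t)) = x s / (s - t)"
      using ne by eventually_elim (simp add: x_def power2_eq_square)
  qed
  \<comment> \<open>The unscaled vector from the intermediate point to the intersection is
    \<open>(s - t) *\<^sub>R v s\<close>, which tends to 0 and so cannot itself witness convergence
    of directions.\<close>
  define v where "v s = (x s / (s - t) - \<alpha>, deriv f t * (x s / (s - t)) - \<alpha> * ((f s - f t) / (s - t)))" for s
  define v0 :: "real \<times> real" where "v0 = (1/2 - \<alpha>) *\<^sub>R (1, deriv f t)"
  have v0: "v0 \<noteq> 0"
    using assms(8) by (simp add: v0_def prod_eq_iff)
  have "(v \<longlongrightarrow> (1/2 - \<alpha>, deriv f t * (1/2) - \<alpha> * deriv f t)) (at t)"
    unfolding v_def by (intro tendsto_intros x_lim slope)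
  then have v_lim: "(v \<longlongrightarrow> v0) (at t)"
    by (simp add: v0_def algebra_simps)
  have f_lim: "(f \<longlongrightarrow> f t) (at t)"
    using D0[OF assms(5)] DERIV_isCont isCont_def by blast
  have "((\<lambda>s. intermediate_point \<alpha> (graph_curve f) t s) \<longlongrightarrow>
      (1 - \<alpha>) *\<^sub>R graph_curve f t + \<alpha> *\<^sub>R graph_curve f t) (at t)"
    unfolding intermediate_point_def graph_curve_def by (intro tendsto_intros f_lim)
  then have p_lim: "((\<lambda>s. intermediate_point \<alpha> (graph_curve f) t s) \<longlongrightarrow> graph_curve f t) (at t)"
    by (simp flip: scaleR_left_distrib)
  have "\<forall>\<^sub>F s in at t. intermediate_line \<alpha> (graph_curve f) t s =
      line_dir (intermediate_point \<alpha> (graph_curve f) t s) (v s)"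
    \<comment> \<open>The three conditions allow removal of the factor \<open>s - t\<close>, give
      differentiability at \<open>s\<close>, and make the intersection formula valid.\<close>
    using ne aI dne
  proof eventually_elim
    case (elim s)
    have "tangent_intersection (graph_curve f) t s = (t + x s, f t + deriv f t * x s)"
      using tangent_intersection_graph_curve[OF d0[OF assms(5)] d0[OF elim(2)] elim(3)]
      by (simp add: x_def)
    moreover have "(s - t) *\<^sub>R v s = (x s - \<alpha> * (s - t), deriv f t * x s - \<alpha> * (f s - f t))"
      using elim(1) by (simp add: v_def right_diff_distrib[of "s - t"])
    ultimately have "tangent_intersection (graph_curve f) t s - intermediate_point \<alpha> (graph_curve f) t s
        = (s - t) *\<^sub>R v s"
      by (simp add: intermediate_point_def graph_curve_def algebra_simps)
    then show ?case
      using elim(1) by (simp add: intermediate_line_def affine_hull_2_line_dir line_dir_scaleR)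
  qed
  with tendsto_imp_eventually_ne[OF v_lim v0]
  have lines: "\<forall>\<^sub>F s in at t. v s \<noteq> 0 \<and> intermediate_line \<alpha> (graph_curve f) t s =
      line_dir (intermediate_point \<alpha> (graph_curve f) t s) (v s)"
    by eventually_elim simp
  have "tangent_line (graph_curve f) t = line_dir (graph_curve f t) v0"
    using assms(8) by (simp add: tangent_line_graph_curve_eq_line_dir d0[OF assms(5)] v0_def
        line_dir_scaleR del: scaleR_Pair)
  with v0 lines p_lim v_lim show ?thesis
    unfolding lines_tendsto_def by blast
qed

end
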